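(* Fix an integer $n\ge 4$, let $C_n=[\cos((i-j)\pi/n)]_{0\le i,j\le n-1}$, and for $\epsilon\ge 0$ let $C_{n,\epsilon}=C_n+\epsilon I_n$, where $I_n$ is the $n\times n$ identity matrix. Let $K_n=\{2,4,\dots,n-4,n-2\}$ (the even integers $k$ with $2\le k\le n-2$) if $n$ is even, and $K_n=\{2,4,\dots,n-5,n-3\}$ (the even integers $k$ with $2\le k\le n-3$) if $n$ is odd. Then for all sufficiently small $\epsilon>0$ (i.e. there is $\epsilon_0>0$, depending on $n$, such that for every $\epsilon\in(0,\epsilon_0)$) the following hold: (i) there exists $\delta>0$ such that $[k-\delta,k+\delta]\subseteq S_{|C_{n,\epsilon}|_\circ}$ for every $k\in K_n$; (ii) $k-1\notin S_{|C_{n,\epsilon}|_\circ}$ for every $k\in K_n$.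
   Context: Let $\mathcal{P}_n$ denote the set of $n\times n$ (symmetric) positive semi-definite matrices with arbitrary real entries. For $A=[a_{ij}]\in\mathcal{P}_n$ and real $\alpha\ge 0$, define the matrix $|A|_\circ^{\circ\alpha}:=[|a_{ij}|^\alpha]$ (entrywise), with the convention $0^0=1$; for $\alpha=1$ it is denoted $|A|_\circ$. For $A\in\mathcal{P}_n$ define $S_{|A|_\circ}:=\{\alpha\ge 0 : |A|_\circ^{\circ\alpha}\in\mathcal{P}_n\}$. The matrices $C_n$ and $C_{n,\epsilon}$ belong to $\mathcal{P}_n$. *)

theory Defs
  imports Complex_Main "Jordan_Normal_Form.Matrix"
begin

definition psd_mats :: "nat \<Rightarrow> real mat set" where
  "psd_mats n = {A \<in> carrier_mat n n.
     transpose_mat A = A \<and> (\<forall>v \<in> carrier_vec n. 0 \<le> v \<bullet> (A *\<^sub>v v))}"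

(* The convention 0^0 = 1 has to be built in, since the library sets 0 powr 0 = 0. *)
definition rpow :: "real \<Rightarrow> real \<Rightarrow> real" where
  "rpow x \<alpha> = (if \<alpha> = 0 then 1 else x powr \<alpha>)"

definition abs_hadamard_pow :: "real mat \<Rightarrow> real \<Rightarrow> real mat" where
  "abs_hadamard_pow A \<alpha> = map_mat (\<lambda>a. rpow \<bar>a\<bar> \<alpha>) A"

(* The set S indexed by the entrywise absolute value of A; meant for square A. *)
definition abs_psd_powers :: "real mat \<Rightarrow> real set" where
  "abs_psd_powers A = {\<alpha>. 0 \<le> \<alpha> \<and> abs_hadamard_pow A \<alpha> \<in> psd_mats (dim_row A)}"

definition cos_mat :: "nat \<Rightarrow> real mat" where
  "cos_mat n = mat n n (\<lambda>(i, j). cos ((real i - real j) * pi / real n))"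

definition cos_mat_eps :: "nat \<Rightarrow> real \<Rightarrow> real mat" where
  "cos_mat_eps n \<epsilon> = cos_mat n + \<epsilon> \<cdot>\<^sub>m 1\<^sub>m n"

definition even_range :: "nat \<Rightarrow> nat set" where
  "even_range n = {k. even k \<and> 2 \<le> k \<and> k \<le> (if even n then n - 2 else n - 3)}"

end

theory Submission
  imports Defs "HOL-Computational_Algebra.Polynomial" "HOL-Analysis.Convex"
begin

text \<open>
  Adding \<open>\<epsilon> I\<close> changes only the diagonal, so the powers studied here are
  \<open>|C\<^sub>n|\<^sup>\<alpha> + ((1 + \<epsilon>)\<^sup>\<alpha> - 1) I\<close>, where the entries of \<open>|C\<^sub>n|\<^sup>\<alpha>\<close>
  are \<open>|cos ((i - j) \<pi> / n)|\<^sup>\<alpha>\<close>.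

  For an even integer \<open>k\<close> the absolute value can be dropped, and \<open>cos\<^sup>k (x - y)\<close> is a positive
  semidefinite kernel by the addition theorem (\<open>cos_power_kernel_nonneg\<close>). The added multiple of
  \<open>I\<close> then makes the matrix positive definite, which is stable under small changes of the
  exponent (\<open>eventually_mem_abs_psd_powers\<close>).

  For an odd integer \<open>p\<close> it suffices that \<open>|C\<^sub>n|\<^sup>p\<close> itself has a negative
  eigenvalue, because a small \<open>\<epsilon>\<close> shifts the spectrum only a little. As \<open>|cos|\<close> has period
  \<open>\<pi>\<close>, the matrix is circulant, and its eigenvalues are the sums of
  \<open>|cos y|\<^sup>p cos (2 m y)\<close> over the points \<open>y = d \<pi> / n\<close> of one period. The representatives
  of a period can be taken in \<open>[-\<pi>/2, \<pi>/2]\<close>, where the cosine is nonnegative; so the absolute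
  value disappears again and its whole effect is the truncation of the sum. For exponent 0 the
  truncated sum is a Dirichlet kernel: at an odd frequency \<open>q\<close> it equals, up to a sign, the
  cotangent (\<open>n\<close> even) or the cosecant (\<open>n\<close> odd) of \<open>q \<pi> / (2 n)\<close>. Multiplication by a
  cosine averages the frequencies \<open>q + 1\<close> and \<open>q - 1\<close>, at which these signs are opposite, so each
  factor \<open>cos y\<close> turns into a difference operator. The eigenvalue is thereby \<open>\<plusminus> 2\<^sup>-\<^sup>p\<close> times a
  \<open>p\<close>-th finite difference of the cotangent or cosecant (\<open>cos_moment_fdiff\<close>).

  All odd derivatives of the cotangent are negative on \<open>(0, \<pi>)\<close>, so these differences have
  a known sign; all even derivatives of the cosecant are positive there, and together with the
  symmetry about \<open>\<pi>/2\<close> this decides its odd differences. Frequency \<open>2 m = p + 3\<close> is the second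
  smallest for which all sample points stay to the right of the pole at 0 (the smallest,
  \<open>p + 1\<close>, gives a positive eigenvalue), and the sample points stay to the left of the pole at
  \<open>\<pi>\<close> for \<open>p + 3 \<le> n\<close>. This yields \<open>cos_moment_neg\<close>.
\<close>

section \<open>Finite differences\<close>

fun fdiff :: "nat \<Rightarrow> real \<Rightarrow> (real \<Rightarrow> real) \<Rightarrow> real \<Rightarrow> real" where
  "fdiff 0 h f x = f x"
| "fdiff (Suc p) h f x = fdiff p h f (x + h) - fdiff p h f x"

lemma fdiff_shift_diff:
  "fdiff p h (\<lambda>y. f (y + u) - f y) x = fdiff p h f (x + u) - fdiff p h f x"
  by (induction p arbitrary: x) (auto simp: add_ac)

lemma fdiff_uminus: "fdiff p h (\<lambda>y. - f y) x = - fdiff p h f x"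
  by (induction p arbitrary: x) auto

lemma fdiff_reflect:
  assumes "\<And>y. f (b - y) = f y"
  shows "fdiff p h f (b - x - real p * h) = (-1) ^ p * fdiff p h f x"
proof (induction p arbitrary: x)
  case 0
  then show ?case using assms by simp
next
  case (Suc p)
  have "fdiff p h f (b - x - real (Suc p) * h + h) = (-1) ^ p * fdiff p h f x"
    using Suc.IH[of x] by (simp add: algebra_simps)
  moreover have "fdiff p h f (b - x - real (Suc p) * h) = (-1) ^ p * fdiff p h f (x + h)"
    using Suc.IH[of "x + h"] by (simp add: algebra_simps)
  ultimately show ?case by (simp add: algebra_simps)
qed

lemma DERIV_pos_on_imp_increasing:
  fixes f f' :: "real \<Rightarrow> real"
  assumes "\<And>z. z \<in> {a<..<b} \<Longrightarrow> (f has_real_derivative f' z) (at z)"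
    and "\<And>z. z \<in> {a<..<b} \<Longrightarrow> 0 < f' z"
    and "a < x" "x < y" "y < b"
  shows "f x < f y"
proof (rule DERIV_pos_imp_increasing[OF \<open>x < y\<close>])
  fix z assume "x \<le> z" "z \<le> y"
  then show "\<exists>D. (f has_real_derivative D) (at z) \<and> 0 < D"
    using assms by (intro exI[of _ "f' z"]) auto
qed

text \<open>
  A finite difference inherits the sign of the derivative of the same order: one difference of
  \<open>f\<close> has derivatives \<open>f i (z + h) - f i z\<close>, and the mean value theorem trades the top
  derivative for the increment. The family \<open>f\<close> lists the successive derivatives of \<open>f 0\<close>.
\<close>

lemma fdiff_pos:
  fixes f :: "nat \<Rightarrow> real \<Rightarrow> real"
  assumes "\<And>i z. z \<in> {a<..<b} \<Longrightarrow> (f i has_real_derivative f (Suc i) z) (at z)"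
    and "\<And>z. z \<in> {a<..<b} \<Longrightarrow> 0 < f p z"
    and "0 < h" "a < x" "x + real p * h < b"
  shows "0 < fdiff p h (f 0) x"
  using assms
proof (induction p arbitrary: f b)
  case 0
  then show ?case by simp
next
  case (Suc p)
  define g where "g = (\<lambda>i z. f i (z + h) - f i z)"
  have "0 < fdiff p h (g 0) x"
  proof (rule Suc.IH[where b = "b - h"])
    show "(g i has_real_derivative g (Suc i) z) (at z)" if "z \<in> {a<..<b - h}" for i z
      unfolding g_def using Suc.prems(1)[of z i] Suc.prems(1)[of "z + h" i] that \<open>0 < h\<close>
      by (intro DERIV_diff) (auto simp: DERIV_shift)
    show "0 < g p z" if "z \<in> {a<..<b - h}" for z
      unfolding g_def
      using DERIV_pos_on_imp_increasing[of a b "f p" "f (Suc p)" z "z + h"]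
        Suc.prems(1)[of _ p] Suc.prems(2) that \<open>0 < h\<close> by auto
  qed (use Suc.prems in \<open>auto simp: algebra_simps\<close>)
  then show ?case
    by (simp add: g_def fdiff_shift_diff)
qed

lemma fdiff_strict_increasing:
  fixes f :: "nat \<Rightarrow> real \<Rightarrow> real"
  assumes deriv: "\<And>i z. z \<in> {a<..<b} \<Longrightarrow> (f i has_real_derivative f (Suc i) z) (at z)"
    and pos: "\<And>z. z \<in> {a<..<b} \<Longrightarrow> 0 < f (Suc p) z"
    and "0 < h" "0 < u" "a < x" "x + u + real p * h < b"
  shows "fdiff p h (f 0) x < fdiff p h (f 0) (x + u)"
proof -
  define g where "g = (\<lambda>i z. f i (z + u) - f i z)"
  have "0 < fdiff p h (g 0) x"
  proof (rule fdiff_pos[where a = a and b = "b - u"])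
    show "(g i has_real_derivative g (Suc i) z) (at z)" if "z \<in> {a<..<b - u}" for i z
      unfolding g_def using deriv[of z i] deriv[of "z + u" i] that \<open>0 < u\<close>
      by (intro DERIV_diff) (auto simp: DERIV_shift)
    show "0 < g p z" if "z \<in> {a<..<b - u}" for z
      unfolding g_def
      using DERIV_pos_on_imp_increasing[of a b "f p" "f (Suc p)" z "z + u"]
        deriv[of _ p] pos that \<open>0 < u\<close> by auto
  qed (use assms in \<open>auto simp: algebra_simps\<close>)
  then show ?thesis
    by (simp add: g_def fdiff_shift_diff)
qed

section \<open>Derivatives of the cotangent and the cosecant\<close>

text \<open>
  The polynomials \<open>P\<^sub>i\<close> with \<open>t\<^sup>(\<^sup>i\<^sup>) = P\<^sub>i(t)\<close> for every solution of \<open>t' = 1 + t\<^sup>2\<close>, such as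
  the tangent and the negated cotangent.
\<close>

fun tan_poly :: "nat \<Rightarrow> real poly" where
  "tan_poly 0 = [:0, 1:]"
| "tan_poly (Suc i) = [:1, 0, 1:] * pderiv (tan_poly i)"

lemma coeff_tan_poly_Suc:
  "coeff (tan_poly (Suc i)) j =
     real (Suc j) * coeff (tan_poly i) (Suc j) +
     (if 2 \<le> j then real (j - 1) * coeff (tan_poly i) (j - 1) else 0)"
  by (cases j; cases "j - 1") (auto simp: coeff_pderiv coeff_pCons split: nat.splits)

lemma coeff_tan_poly_nonneg: "0 \<le> coeff (tan_poly i) j"
proof (induction i arbitrary: j)
  case 0
  then show ?case by (auto simp: coeff_pCons split: nat.splits)
next
  case (Suc i)
  show ?case unfolding coeff_tan_poly_Suc using Suc by simp
qed

lemma coeff_tan_poly_parity: "even (i + j) \<Longrightarrow> coeff (tan_poly i) j = 0"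
proof (induction i arbitrary: j)
  case 0
  then show ?case by (auto simp: coeff_pCons split: nat.splits)
next
  case (Suc i)
  then show ?case unfolding coeff_tan_poly_Suc by auto
qed

lemma coeff_tan_poly_low: "0 < coeff (tan_poly (2 * i)) 1" "0 < coeff (tan_poly (Suc (2 * i))) 0"
proof -
  show *: "0 < coeff (tan_poly (2 * i)) 1"
  proof (induction i)
    case (Suc i)
    have "0 \<le> coeff (tan_poly (2 * i)) 3"
      by (rule coeff_tan_poly_nonneg)
    then show ?case using Suc
      by (simp add: coeff_tan_poly_Suc numeral_2_eq_2 numeral_3_eq_3 del: tan_poly.simps)
  qed auto
  then show "0 < coeff (tan_poly (Suc (2 * i))) 0"
    by (simp add: coeff_tan_poly_Suc del: tan_poly.simps)
qed

text \<open>
  For odd \<open>i\<close> only even powers occur, all with nonnegative coefficients, and the constant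
  term is positive.
\<close>

lemma poly_tan_poly_pos:
  assumes "odd i"
  shows "0 < poly (tan_poly i) y"
proof -
  have nonneg: "0 \<le> coeff (tan_poly i) j * y ^ j" for j
    using coeff_tan_poly_nonneg[of i j] coeff_tan_poly_parity[of i j] assms
    by (cases "even j") auto
  have "0 < coeff (tan_poly i) 0 * y ^ 0"
    using assms coeff_tan_poly_low(2) by (auto elim: oddE)
  then show ?thesis
    unfolding poly_altdef by (intro sum_pos2[of _ 0] nonneg) auto
qed

definition neg_cot_deriv :: "nat \<Rightarrow> real \<Rightarrow> real" where
  "neg_cot_deriv i x = poly (tan_poly i) (- cot x)"

lemma neg_cot_deriv_0: "neg_cot_deriv 0 = (\<lambda>x. - cot x)"
  by (simp add: neg_cot_deriv_def fun_eq_iff)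

lemma has_derivative_neg_cot_deriv:
  assumes "x \<in> {0<..<pi}"
  shows "(neg_cot_deriv i has_real_derivative neg_cot_deriv (Suc i) x) (at x)"
proof -
  have s: "sin x \<noteq> 0" using sin_gt_zero[of x] assms by auto
  have "inverse ((sin x)\<^sup>2) = 1 + (cot x)\<^sup>2"
    using s by (simp add: cot_def field_simps)
  then have "((\<lambda>x. - cot x) has_real_derivative 1 + (- cot x)\<^sup>2) (at x)"
    using DERIV_minus[OF DERIV_cot[OF s]] by (simp add: add.commute)
  from DERIV_chain2[OF poly_DERIV this, of "tan_poly i"]
  show ?thesis
    unfolding neg_cot_deriv_def by (simp add: power2_eq_square algebra_simps)
qed

lemma neg_cot_deriv_pos: "odd i \<Longrightarrow> 0 < neg_cot_deriv i x"
  unfolding neg_cot_deriv_def by (rule poly_tan_poly_pos)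

text \<open>
  From \<open>2 / sin x = cot (x/2) + tan (x/2) = cot (x/2) - cot (x/2 + \<pi>/2)\<close>, derivatives of the
  cosecant are increments of derivatives of the cotangent.
\<close>

definition csc_deriv :: "nat \<Rightarrow> real \<Rightarrow> real" where
  "csc_deriv i x = (neg_cot_deriv i (x / 2 + pi / 2) - neg_cot_deriv i (x / 2)) / 2 ^ Suc i"

lemma csc_deriv_0:
  "csc_deriv 0 = (\<lambda>x. 1 / sin x)"
proof
  fix x :: real
  have c: "cot (x / 2 + pi / 2) = - sin (x / 2) / cos (x / 2)"
    by (simp add: cot_def sin_add cos_add)
  have s: "sin x = 2 * sin (x / 2) * cos (x / 2)"
    using sin_double[of "x / 2"] by simp
  show "csc_deriv 0 x = 1 / sin x"
  proof (cases "sin (x / 2) = 0 \<or> cos (x / 2) = 0")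
    case True
    then show ?thesis
      unfolding csc_deriv_def neg_cot_deriv_0 c s by (auto simp: cot_def)
  next
    case False
    then show ?thesis
      unfolding csc_deriv_def neg_cot_deriv_0 c s
      using sin_cos_squared_add[of "x / 2"]
      by (simp add: cot_def divide_simps power2_eq_square)
  qed
qed

lemma has_derivative_csc_deriv:
  assumes "x \<in> {0<..<pi}"
  shows "(csc_deriv i has_real_derivative csc_deriv (Suc i) x) (at x)"
proof -
  have "((\<lambda>x. neg_cot_deriv i (x / 2 + pi / 2)) has_real_derivative
          neg_cot_deriv (Suc i) (x / 2 + pi / 2) * (1 / 2)) (at x)"
    by (rule DERIV_chain2[OF has_derivative_neg_cot_deriv])
      (use assms in \<open>auto intro!: derivative_eq_intros\<close>)
  moreover have "((\<lambda>x. neg_cot_deriv i (x / 2)) has_real_derivative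
          neg_cot_deriv (Suc i) (x / 2) * (1 / 2)) (at x)"
    by (rule DERIV_chain2[OF has_derivative_neg_cot_deriv])
      (use assms in \<open>auto intro!: derivative_eq_intros\<close>)
  ultimately have "((\<lambda>x. neg_cot_deriv i (x / 2 + pi / 2) - neg_cot_deriv i (x / 2))
      has_real_derivative (neg_cot_deriv (Suc i) (x / 2 + pi / 2) * (1 / 2) -
          neg_cot_deriv (Suc i) (x / 2) * (1 / 2))) (at x)"
    by (rule DERIV_diff)
  from DERIV_cdivide[OF this, of "2 ^ Suc i"] show ?thesis
    unfolding csc_deriv_def by (simp add: field_simps)
qed

text \<open>
  Even derivatives of the negated cotangent increase on \<open>(0, \<pi>)\<close>, because its odd derivatives are
  positive.
\<close>

lemma csc_deriv_pos:
  assumes "even i" "x \<in> {0<..<pi}"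
  shows "0 < csc_deriv i x"
proof -
  have "neg_cot_deriv i (x / 2) < neg_cot_deriv i (x / 2 + pi / 2)"
    by (rule DERIV_pos_on_imp_increasing[of 0 pi _ "neg_cot_deriv (Suc i)"])
      (use assms has_derivative_neg_cot_deriv neg_cot_deriv_pos in auto)
  then show ?thesis by (simp add: csc_deriv_def)
qed

lemma fdiff_cot_neg:
  assumes "odd p" "0 < h" "0 < x" "x + real p * h < pi"
  shows "fdiff p h cot x < 0"
proof -
  have "0 < fdiff p h (neg_cot_deriv 0) x"
    by (rule fdiff_pos[where a = 0 and b = pi])
      (use assms has_derivative_neg_cot_deriv neg_cot_deriv_pos in auto)
  then show ?thesis by (simp add: neg_cot_deriv_0 fdiff_uminus)
qed

text \<open>
  Odd derivatives of the cosecant change sign at \<open>\<pi>/2\<close>, so a bound on the sample points alone does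
  not suffice: the hypothesis says that their midpoint lies to the left of \<open>\<pi>/2\<close>. An odd
  difference changes sign when its sample points are reflected in \<open>\<pi>/2\<close>, and it is strictly
  smaller on the left copy than on the right copy; so it is negative on the left.
\<close>

lemma fdiff_csc_neg:
  assumes "odd p" "0 < h" "0 < x" "2 * x + real p * h < pi"
  shows "fdiff p h (\<lambda>y. 1 / sin y) x < 0"
proof -
  define u where "u = pi - 2 * x - real p * h"
  have "fdiff p h (csc_deriv 0) x < fdiff p h (csc_deriv 0) (x + u)"
    by (rule fdiff_strict_increasing[where a = 0 and b = pi])
      (use assms has_derivative_csc_deriv csc_deriv_pos in \<open>auto simp: u_def\<close>)
  moreover have "fdiff p h (csc_deriv 0) (x + u) = - fdiff p h (csc_deriv 0) x"
    using fdiff_reflect[of "csc_deriv 0" pi p h x] \<open>odd p\<close>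
    by (simp add: csc_deriv_0 u_def algebra_simps)
  ultimately show ?thesis by (simp add: csc_deriv_0)
qed

section \<open>Eigenvalues of the circulant matrix\<close>

text \<open>
  For \<open>p > 0\<close> and \<open>q = 2 m\<close> this is the eigenvalue of \<open>|C\<^sub>n|\<^sup>p\<close> at the \<open>m\<close>-th discrete
  Fourier mode. Only points with \<open>cos > 0\<close> enter, so the absolute value is not written. Odd \<open>q\<close>
  and \<open>p = 0\<close>, where it is no eigenvalue, are needed for the recursion in \<open>p\<close>.
\<close>

definition cos_moment :: "nat \<Rightarrow> nat \<Rightarrow> int \<Rightarrow> real" where
  "cos_moment n p q =
     (\<Sum>d | 2 * \<bar>d\<bar> < int n. cos (of_int d * pi / n) ^ p * cos (of_int q * (of_int d * pi / n)))"

lemma half_interval_eq: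
  assumes "0 < n"
  shows "{d :: int. 2 * \<bar>d\<bar> < int n} = {- int ((n - 1) div 2)..int ((n - 1) div 2)}"
  using assms by auto

lemma sin_times_sum_cos:
  "sin (x / 2) * (\<Sum>d = - int L..int L. cos (of_int d * x)) = sin ((2 * real L + 1) * x / 2)"
proof (induction L)
  case (Suc L)
  have "{- int (Suc L)..int (Suc L)} =
      insert (- int (Suc L)) (insert (int (Suc L)) {- int L..int L})"
    by auto
  moreover have "cos (of_int (- int (Suc L)) * x) = cos (real (Suc L) * x)"
    by (simp del: of_nat_Suc)
  ultimately have "(\<Sum>d = - int (Suc L)..int (Suc L). cos (of_int d * x)) =
      (\<Sum>d = - int L..int L. cos (of_int d * x)) + 2 * cos (real (Suc L) * x)"
    by (simp del: of_nat_Suc)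
  then have "sin (x / 2) * (\<Sum>d = - int (Suc L)..int (Suc L). cos (of_int d * x)) =
      sin ((2 * real L + 1) * x / 2) + 2 * sin (x / 2) * cos (real (Suc L) * x)"
    using Suc by (simp add: algebra_simps)
  also have "sin ((2 * real L + 1) * x / 2) = sin (real (Suc L) * x - x / 2)"
    by (simp add: field_simps)
  also have "\<dots> + 2 * sin (x / 2) * cos (real (Suc L) * x) = sin (real (Suc L) * x + x / 2)"
    unfolding sin_add sin_diff by simp
  finally show ?case by (simp add: field_simps)
qed simp

definition dirichlet_quotient :: "nat \<Rightarrow> real \<Rightarrow> real" where
  "dirichlet_quotient n = (if even n then cot else (\<lambda>x. 1 / sin x))"

lemma sin_odd_multiple_nonzero:
  assumes "0 < n" "odd q"
  shows "sin (of_int q * pi / (2 * real n)) \<noteq> 0"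
proof
  assume "sin (of_int q * pi / (2 * real n)) = 0"
  then obtain i :: int where "of_int q * pi / (2 * real n) = of_int i * pi"
    by (auto simp: sin_zero_iff_int2)
  then have "of_int q = (2 * real n) * of_int i"
    using assms by (simp add: field_simps)
  then have "of_int q = (of_int (2 * int n * i) :: real)" by simp
  then have "q = 2 * int n * i" by (simp only: of_int_eq_iff)
  with assms show False by simp
qed

lemma cos_odd_half_pi: "odd q \<Longrightarrow> cos (of_int q * pi / 2) = 0"
  by (auto simp: cos_zero_iff_int)

text \<open>
  The closed form of the Dirichlet kernel has numerator \<open>sin (q \<pi> / 2)\<close> for odd \<open>n\<close>, when there
  are \<open>n\<close> terms. For even \<open>n\<close> there are \<open>n - 1\<close> terms, and the numerator is
  \<open>sin (q \<pi> / 2 - q \<pi> / (2 n))\<close>; since \<open>q\<close> is odd, this leaves an additional factor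
  \<open>cos (q \<pi> / (2 n))\<close>.
\<close>

lemma cos_moment_0:
  assumes "0 < n" "odd q"
  shows "cos_moment n 0 q =
    sin (of_int q * pi / 2) * dirichlet_quotient n (of_int q * pi / (2 * real n))"
proof -
  define x where "x = of_int q * pi / real n"
  define L where "L = (n - 1) div 2"
  have nz: "sin (x / 2) \<noteq> 0"
    using sin_odd_multiple_nonzero[OF assms] by (simp add: x_def mult.commute)
  have "cos_moment n 0 q = (\<Sum>d = - int L..int L. cos (of_int d * x))"
    unfolding cos_moment_def half_interval_eq[OF \<open>0 < n\<close>] L_def x_def
    by (simp add: mult_ac)
  then have eq: "sin (x / 2) * cos_moment n 0 q = sin ((2 * real L + 1) * x / 2)"
    using sin_times_sum_cos by simp
  show ?thesis
  proof (cases "even n")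
    case True
    then have "2 * real L + 1 = real n - 1"
      using \<open>0 < n\<close> by (cases n) (auto simp: L_def elim!: oddE)
    then have "(2 * real L + 1) * x / 2 = (real n - 1) * x / 2"
      by simp
    also have "\<dots> = of_int q * pi / 2 - x / 2"
      using \<open>0 < n\<close> by (simp add: x_def field_simps)
    finally have arg: "(2 * real L + 1) * x / 2 = of_int q * pi / 2 - x / 2" .
    have "sin (x / 2) * cos_moment n 0 q = sin (of_int q * pi / 2) * cos (x / 2)"
      using eq unfolding arg sin_diff cos_odd_half_pi[OF \<open>odd q\<close>] by simp
    then have "cos_moment n 0 q = sin (of_int q * pi / 2) * cot (x / 2)"
      using nz by (simp add: cot_def field_simps)
    with True show ?thesis by (simp add: dirichlet_quotient_def x_def mult.commute)
  next
    case False
    then have "2 * real L + 1 = real n"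
      by (auto simp: L_def elim!: oddE)
    then have "sin (x / 2) * cos_moment n 0 q = sin (of_int q * pi / 2)"
      using eq \<open>0 < n\<close> by (simp add: x_def)
    then have "cos_moment n 0 q = sin (of_int q * pi / 2) * (1 / sin (x / 2))"
      using nz by (simp add: field_simps)
    with False show ?thesis by (simp add: dirichlet_quotient_def x_def mult.commute)
  qed
qed

lemma cos_moment_Suc:
  "2 * cos_moment n (Suc p) q = cos_moment n p (q + 1) + cos_moment n p (q - 1)"
  unfolding cos_moment_def sum_distrib_left sum.distrib[symmetric]
proof (rule sum.cong[OF refl])
  fix d :: int
  define y where "y = of_int d * pi / real n"
  have "cos (of_int (q + 1) * y) + cos (of_int (q - 1) * y) = 2 * cos y * cos (of_int q * y)"
    by (simp add: distrib_right left_diff_distrib cos_add cos_diff)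
  then show "2 * (cos y ^ Suc p * cos (of_int q * y)) =
      cos y ^ p * cos (of_int (q + 1) * y) + cos y ^ p * cos (of_int (q - 1) * y)"
    by (simp add: distrib_left[symmetric])
qed

text \<open>
  The recursion \<open>cos_moment_Suc\<close> takes a mean, but the factor \<open>sin (q \<pi> / 2)\<close> of the case
  \<open>p = 0\<close> alternates along odd \<open>q\<close> and turns the mean into a difference.
\<close>

lemma cos_moment_fdiff:
  assumes "0 < n" "odd (q + int p)"
  shows "2 ^ p * cos_moment n p q =
    sin (of_int (q + int p) * pi / 2) *
    fdiff p (pi / n) (dirichlet_quotient n) (of_int (q - int p) * pi / (2 * real n))"
  using assms(2)
proof (induction p arbitrary: q)
  case 0
  then show ?case using cos_moment_0[OF \<open>0 < n\<close>] by simp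
next
  case (Suc p)
  let ?D = "fdiff p (pi / n) (dirichlet_quotient n)"
  let ?s = "sin (of_int (q + int (Suc p)) * pi / 2)"
  let ?x = "of_int (q - int (Suc p)) * pi / (2 * real n)"
  have s: "sin (of_int (q - 1 + int p) * pi / 2) = - ?s"
  proof -
    have "of_int (q - 1 + int p) * pi / 2 = of_int (q + int (Suc p)) * pi / 2 - pi"
      by (simp add: field_simps)
    then show ?thesis by (simp only: sin_diff) simp
  qed
  have x: "of_int (q + 1 - int p) * pi / (2 * real n) = ?x + pi / n"
    using \<open>0 < n\<close> by (simp add: field_simps)
  have "2 ^ Suc p * cos_moment n (Suc p) q =
      2 ^ p * cos_moment n p (q + 1) + 2 ^ p * cos_moment n p (q - 1)"
    using cos_moment_Suc[of n p q] by (simp add: distrib_left[symmetric])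
  also have "2 ^ p * cos_moment n p (q + 1) = ?s * ?D (?x + pi / n)"
    using Suc.IH[of "q + 1"] Suc.prems x by (simp add: add_ac)
  also have "2 ^ p * cos_moment n p (q - 1) = - ?s * ?D ?x"
    using Suc.IH[of "q - 1"] Suc.prems s by (simp add: algebra_simps)
  finally show ?case by (simp add: algebra_simps)
qed

lemma cos_moment_neg:
  assumes "odd p" "p + 3 \<le> n"
  shows "cos_moment n p (int p + 3) < 0"
proof -
  have n: "0 < n" using assms by simp
  let ?x = "3 * pi / (2 * real n)"
  have "sin (of_int (int p + 3 + int p) * pi / 2) = sin (real p * pi + 3 * pi / 2)"
    by (simp add: field_simps)
  also have "\<dots> = sin (real p * pi + (pi + pi / 2))"
    by (simp add: field_simps)
  also have "\<dots> = 1"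
    unfolding sin_add using \<open>odd p\<close> by simp
  \<comment> \<open>So the sign factor is positive, and the frequency \<open>p + 3\<close> puts the leftmost sample at \<open>?x\<close>.\<close>
  finally have s: "sin (of_int (int p + 3 + int p) * pi / 2) = 1" .
  have eq: "2 ^ p * cos_moment n p (int p + 3) = fdiff p (pi / n) (dirichlet_quotient n) ?x"
    using cos_moment_fdiff[OF n, of "int p + 3" p] \<open>odd p\<close> s by simp
  have "fdiff p (pi / n) (dirichlet_quotient n) ?x < 0"
  proof (cases "even n")
    case True
    have "?x + real p * (pi / n) = (2 * real p + 3) / (2 * real n) * pi"
      using n by (simp add: field_simps)
    also have "\<dots> < 1 * pi"
      using assms n by (intro mult_strict_right_mono) (auto simp: field_simps)
    finally show ?thesis
      using fdiff_cot_neg[of p "pi / n" ?x] True \<open>odd p\<close> n by (simp add: dirichlet_quotient_def)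
  next
    case False
    \<comment> \<open>Parity makes the bound strict, which puts the midpoint of the samples to the left of \<open>\<pi>/2\<close>.\<close>
    then have "p + 3 \<noteq> n" using \<open>odd p\<close> by auto
    then have "p + 3 < n" using assms by simp
    have "2 * ?x + real p * (pi / n) = (real p + 3) / real n * pi"
      using n by (simp add: field_simps)
    also have "\<dots> < 1 * pi"
      using \<open>p + 3 < n\<close> n by (intro mult_strict_right_mono) (auto simp: field_simps)
    finally show ?thesis
      using fdiff_csc_neg[of p "pi / n" ?x] False \<open>odd p\<close> n by (simp add: dirichlet_quotient_def)
  qed
  then show ?thesis
    using eq by (metis mult_less_0_iff zero_less_numeral zero_less_power less_asym)
qed

section \<open>Quadratic forms\<close>

lemma sum_periodic:
  fixes f :: "int \<Rightarrow> real"
  assumes "\<And>d. f (d + int n) = f d"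
  shows "(\<Sum>d = a..<a + int n. f d) = (\<Sum>d = b..<b + int n. f d)"
proof -
  define S where "S = (\<lambda>a. \<Sum>d = a..<a + int n. f d)"
  have step: "S (a + 1) = S a" for a
  proof (cases "n = 0")
    case False
    have "insert (a + int n) {a..<a + int n} = insert a {a + 1..<a + 1 + int n}"
      using False by auto
    then have "sum f (insert (a + int n) {a..<a + int n}) = sum f (insert a {a + 1..<a + 1 + int n})"
      by simp
    then show ?thesis using assms by (simp add: S_def)
  qed (simp add: S_def)
  have "S a = S 0" for a
  proof (induction a rule: int_induct[of _ 0])
    case (step2 i)
    then show ?case using step[of "i - 1"] by simp
  qed (use step in simp_all)
  then show ?thesis unfolding S_def by metis
qed

lemma double_sum_periodic:
  fixes f :: "int \<Rightarrow> real"
  assumes "\<And>d. f (d + int n) = f d"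
  shows "(\<Sum>i<n. \<Sum>j<n. f (int i - int j)) = real n * (\<Sum>d = a..<a + int n. f d)"
proof -
  have "(\<Sum>i<n. f (int i - int j)) = (\<Sum>d = a..<a + int n. f d)" for j
  proof -
    have "(\<Sum>i<n. f (int i - int j)) = (\<Sum>d = - int j..<- int j + int n. f d)"
      by (rule sum.reindex_bij_witness[of _ "\<lambda>d. nat (d + int j)" "\<lambda>i. int i - int j"]) auto
    also have "\<dots> = (\<Sum>d = a..<a + int n. f d)"
      by (rule sum_periodic) (rule assms)
    finally show ?thesis .
  qed
  then show ?thesis
    by (subst sum.swap) simp
qed

text \<open>
  Both factors of the summand depend only on \<open>i - j\<close> modulo \<open>n\<close>, so every column contributes the same
  sum over one period. The period is chosen centred at 0; for even \<open>n\<close> it contains one point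
  with \<open>|d| = n/2\<close>, where the cosine vanishes, and the hypothesis \<open>p > 0\<close> removes it.
\<close>

lemma sum_abs_cos_pow_eq_cos_moment:
  assumes "0 < n" "0 < p"
  shows "(\<Sum>i<n. \<Sum>j<n. \<bar>cos ((real i - real j) * pi / n)\<bar> ^ p *
            cos (2 * real m * ((real i - real j) * pi / n))) =
         real n * cos_moment n p (2 * int m)"
proof -
  define f :: "int \<Rightarrow> real" where
    "f d = \<bar>cos (of_int d * pi / n)\<bar> ^ p * cos (2 * real m * (of_int d * pi / n))" for d
  have per: "f (d + int n) = f d" for d
  proof -
    have "of_int (d + int n) * pi / n = of_int d * pi / n + pi"
      using \<open>0 < n\<close> by (simp add: field_simps)
    moreover have "cos (2 * real m * (y + pi)) = cos (2 * real m * y)" for y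
    proof -
      have "2 * real m * (y + pi) = 2 * real m * y + of_int (int m) * (2 * pi)"
        by (simp add: algebra_simps)
      then show ?thesis
        using cos_int_2pin[of "int m"] sin_int_2pin[of "int m"]
        by (simp add: cos_add mult_ac)
    qed
    ultimately show ?thesis by (simp add: f_def)
  qed
  let ?M = "int (n div 2)"
  have "(\<Sum>d = -?M..<-?M + int n. f d) = (\<Sum>d | 2 * \<bar>d\<bar> < int n. f d)"
  proof (rule sum.mono_neutral_right)
    show "{d. 2 * \<bar>d\<bar> < int n} \<subseteq> {-?M..<-?M + int n}" by auto
    show "\<forall>d \<in> {-?M..<-?M + int n} - {d. 2 * \<bar>d\<bar> < int n}. f d = 0"
    proof
      fix d assume "d \<in> {-?M..<-?M + int n} - {d. 2 * \<bar>d\<bar> < int n}"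
      then have "2 * d = - int n" by auto
      then have "of_int (2 * d) = (of_int (- int n) :: real)" by simp
      then have "of_int d * pi / n = - (pi / 2)"
        using \<open>0 < n\<close> by (simp add: field_simps)
      then show "f d = 0" using \<open>0 < p\<close> by (simp add: f_def)
    qed
  qed simp
  also have "\<dots> = cos_moment n p (2 * int m)"
    unfolding cos_moment_def
  proof (rule sum.cong[OF refl])
    fix d :: int assume "d \<in> {d. 2 * \<bar>d\<bar> < int n}"
    then have "2 * \<bar>d\<bar> < int n" by simp
    then have "of_int (2 * \<bar>d\<bar>) < (of_int (int n) :: real)" by (simp only: of_int_less_iff)
    then have "\<bar>of_int d\<bar> / real n * pi \<le> 1 / 2 * pi"
      using \<open>0 < n\<close> by (intro mult_right_mono) (auto simp: field_simps)
    then have "\<bar>of_int d * pi / n\<bar> \<le> pi / 2"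
      by (simp add: abs_mult)
    then have "0 \<le> cos (of_int d * pi / n)"
      unfolding abs_le_iff by (intro cos_ge_zero) linarith+
    then show "f d = cos (of_int d * pi / n) ^ p *
        cos (of_int (2 * int m) * (of_int d * pi / n))"
      by (simp add: f_def)
  qed
  finally have "(\<Sum>d = -?M..<-?M + int n. f d) = cos_moment n p (2 * int m)" .
  with double_sum_periodic[of f n "-?M", OF per] show ?thesis
    by (simp add: f_def)
qed

text \<open>
  By the addition theorem, one factor \<open>cos (x i - x j)\<close> splits the form into two forms with
  exponent \<open>k\<close>, at the vectors \<open>v cos x\<close> and \<open>v sin x\<close>; this is the Schur product theorem for a
  kernel of rank two.
\<close>

lemma cos_power_kernel_nonneg:
  fixes v x :: "nat \<Rightarrow> real"
  shows "0 \<le> (\<Sum>i<n. \<Sum>j<n. v i * v j * cos (x i - x j) ^ k)"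
proof (induction k arbitrary: v)
  case 0
  have "(\<Sum>i<n. \<Sum>j<n. v i * v j) = (\<Sum>i<n. v i)\<^sup>2"
    by (simp add: power2_eq_square sum_product)
  then show ?case by simp
next
  case (Suc k)
  have "(\<Sum>i<n. \<Sum>j<n. v i * v j * cos (x i - x j) ^ Suc k) =
      (\<Sum>i<n. \<Sum>j<n. (v i * cos (x i)) * (v j * cos (x j)) * cos (x i - x j) ^ k) +
      (\<Sum>i<n. \<Sum>j<n. (v i * sin (x i)) * (v j * sin (x j)) * cos (x i - x j) ^ k)"
    unfolding sum.distrib[symmetric]
    by (intro sum.cong refl) (simp add: cos_diff algebra_simps)
  also have "\<dots> \<ge> 0"
    using Suc[of "\<lambda>i. v i * cos (x i)"] Suc[of "\<lambda>i. v i * sin (x i)"] by simp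
  finally show ?case .
qed

text \<open>
  The perturbation is written as a summand on the diagonal, so that the quadratic form splits
  into that of \<open>|C\<^sub>n|\<^sup>\<alpha>\<close> and a multiple of the squared norm.
\<close>

definition cos_eps_entry :: "nat \<Rightarrow> real \<Rightarrow> real \<Rightarrow> nat \<Rightarrow> nat \<Rightarrow> real" where
  "cos_eps_entry n \<epsilon> \<alpha> i j =
     \<bar>cos ((real i - real j) * pi / n)\<bar> powr \<alpha> + (if i = j then (1 + \<epsilon>) powr \<alpha> - 1 else 0)"

lemma mem_abs_psd_powers_iff:
  assumes "0 \<le> \<epsilon>" "0 < \<alpha>"
  shows "\<alpha> \<in> abs_psd_powers (cos_mat_eps n \<epsilon>) \<longleftrightarrow>
    (\<forall>v. 0 \<le> (\<Sum>i<n. \<Sum>j<n. v i * v j * cos_eps_entry n \<epsilon> \<alpha> i j))"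
proof -
  let ?A = "abs_hadamard_pow (cos_mat_eps n \<epsilon>) \<alpha>"
  have dim: "cos_mat_eps n \<epsilon> \<in> carrier_mat n n"
    by (simp add: cos_mat_eps_def cos_mat_def)
  then have dimA: "?A \<in> carrier_mat n n"
    by (simp add: abs_hadamard_pow_def)
  have entry: "?A $$ (i, j) = cos_eps_entry n \<epsilon> \<alpha> i j" if "i < n" "j < n" for i j
    using that assms dim
    by (auto simp: abs_hadamard_pow_def cos_mat_eps_def cos_mat_def rpow_def cos_eps_entry_def)
  have sym: "cos_eps_entry n \<epsilon> \<alpha> j i = cos_eps_entry n \<epsilon> \<alpha> i j" for i j
  proof -
    have "(real j - real i) * pi / n = - ((real i - real j) * pi / n)"
      by (simp add: minus_divide_left left_diff_distrib)
    then show ?thesis by (simp only: cos_eps_entry_def cos_minus eq_commute[of i j])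
  qed
  have transpose: "transpose_mat ?A = ?A"
    using dimA entry sym by (intro eq_matI) auto
  have form: "v \<bullet> (?A *\<^sub>v v) = (\<Sum>i<n. \<Sum>j<n. v $ i * v $ j * cos_eps_entry n \<epsilon> \<alpha> i j)"
    if "v \<in> carrier_vec n" for v
  proof -
    have "v \<bullet> (?A *\<^sub>v v) = (\<Sum>i<n. v $ i * (\<Sum>j<n. ?A $$ (i, j) * v $ j))"
      using that dimA by (auto simp: scalar_prod_def lessThan_atLeast0 intro!: sum.cong)
    also have "\<dots> = (\<Sum>i<n. \<Sum>j<n. v $ i * v $ j * cos_eps_entry n \<epsilon> \<alpha> i j)"
      by (auto simp: sum_distrib_left entry mult_ac intro!: sum.cong)
    finally show ?thesis .
  qed
  have "\<alpha> \<in> abs_psd_powers (cos_mat_eps n \<epsilon>) \<longleftrightarrow> (\<forall>v \<in> carrier_vec n. 0 \<le> v \<bullet> (?A *\<^sub>v v))"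
    using assms dim dimA transpose by (auto simp: abs_psd_powers_def psd_mats_def)
  also have "\<dots> \<longleftrightarrow> (\<forall>v. 0 \<le> (\<Sum>i<n. \<Sum>j<n. v i * v j * cos_eps_entry n \<epsilon> \<alpha> i j))"
  proof (intro iffI allI ballI)
    fix v :: "nat \<Rightarrow> real"
    assume "\<forall>v \<in> carrier_vec n. 0 \<le> v \<bullet> (?A *\<^sub>v v)"
    then have "0 \<le> vec n v \<bullet> (?A *\<^sub>v vec n v)" by simp
    then show "0 \<le> (\<Sum>i<n. \<Sum>j<n. v i * v j * cos_eps_entry n \<epsilon> \<alpha> i j)"
      by (simp add: form)
  qed (simp add: form)
  finally show ?thesis .
qed

lemma cos_eps_form:
  "(\<Sum>i<n. \<Sum>j<n. v i * v j * cos_eps_entry n \<epsilon> \<alpha> i j) =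
   (\<Sum>i<n. \<Sum>j<n. v i * v j * \<bar>cos ((real i - real j) * pi / n)\<bar> powr \<alpha>) +
   ((1 + \<epsilon>) powr \<alpha> - 1) * (\<Sum>i<n. (v i)\<^sup>2)"
proof -
  have "(\<Sum>j<n. v i * v j * cos_eps_entry n \<epsilon> \<alpha> i j) =
      (\<Sum>j<n. v i * v j * \<bar>cos ((real i - real j) * pi / n)\<bar> powr \<alpha>) +
      ((1 + \<epsilon>) powr \<alpha> - 1) * (v i)\<^sup>2" if "i < n" for i
  proof -
    have "(\<Sum>j<n. v i * v j * (if i = j then (1 + \<epsilon>) powr \<alpha> - 1 else 0)) =
        (\<Sum>j<n. if i = j then v i * v j * ((1 + \<epsilon>) powr \<alpha> - 1) else 0)"
      by (intro sum.cong) auto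
    also have "\<dots> = ((1 + \<epsilon>) powr \<alpha> - 1) * (v i)\<^sup>2"
      using that by (simp add: power2_eq_square)
    finally show ?thesis
      by (simp add: cos_eps_entry_def distrib_left sum.distrib)
  qed
  then show ?thesis
    by (simp add: sum.distrib sum_distrib_left)
qed

section \<open>Exponents near even integers and exponents at odd integers\<close>

lemma sum_abs_square_le:
  fixes v :: "nat \<Rightarrow> real"
  shows "(\<Sum>i<n. \<bar>v i\<bar>)\<^sup>2 \<le> real n * (\<Sum>i<n. (v i)\<^sup>2)"
  using sum_squared_le_sum_of_squares[of "\<lambda>i. \<bar>v i\<bar>" "{..<n}"] by (simp add: mult.commute)

lemma isCont_powr_exponent:
  fixes x \<alpha> :: real
  assumes "0 \<le> x"
  shows "isCont (\<lambda>a. x powr a) \<alpha>"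
  by (cases "x = 0") (use assms in \<open>auto intro!: continuous_intros\<close>)

text \<open>
  The form at \<open>k\<close> without the perturbation is nonnegative, and the perturbation adds at least
  \<open>\<epsilon> |v|\<^sup>2\<close> as soon as \<open>\<alpha> \<ge> 1\<close>. If every entry moves by less than \<open>\<epsilon> / n\<close>, the form changes by
  at most \<open>\<epsilon> / n (\<Sum>|v i|)\<^sup>2 \<le> \<epsilon> |v|\<^sup>2\<close>.
\<close>

lemma eventually_mem_abs_psd_powers:
  assumes "0 < n" "even k" "2 \<le> k" "0 < \<epsilon>"
  shows "\<forall>\<^sub>F \<alpha> in nhds (real k). \<alpha> \<in> abs_psd_powers (cos_mat_eps n \<epsilon>)"
proof -
  define c where "c i j = \<bar>cos ((real i - real j) * pi / n)\<bar>" for i j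
  define \<eta> where "\<eta> = \<epsilon> / n"
  have \<eta>: "0 < \<eta>" using assms by (simp add: \<eta>_def)
  have "\<forall>\<^sub>F \<alpha> in nhds (real k). \<bar>c i j powr \<alpha> - c i j powr real k\<bar> < \<eta>" for i j
  proof -
    have "((\<lambda>a. c i j powr a) \<longlongrightarrow> c i j powr real k) (nhds (real k))"
      using isCont_powr_exponent[of "c i j" "real k"]
      by (simp add: c_def continuous_at_imp_continuous_at_within isCont_def tendsto_at_iff_tendsto_nhds)
    from tendstoD[OF this \<eta>] show ?thesis by (simp add: dist_real_def)
  qed
  then have close: "\<forall>\<^sub>F \<alpha> in nhds (real k).
      \<forall>i \<in> {..<n}. \<forall>j \<in> {..<n}. \<bar>c i j powr \<alpha> - c i j powr real k\<bar> < \<eta>"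
    by (intro eventually_ball_finite ballI) auto
  have "\<forall>\<^sub>F \<alpha> in nhds (real k). 1 < \<alpha>"
    using assms by (intro eventually_nhds_in_open[of "{1<..}", simplified]) auto
  with close show ?thesis
  proof eventually_elim
    case (elim \<alpha>)
    have "0 \<le> (\<Sum>i<n. \<Sum>j<n. v i * v j * cos_eps_entry n \<epsilon> \<alpha> i j)" for v
    proof -
      have ck: "c i j powr real k = cos (real i * pi / n - real j * pi / n) ^ k" for i j
      proof -
        have "c i j powr real k = c i j ^ k"
          using assms by (cases "c i j = 0") (auto simp: powr_realpow c_def)
        also have "\<dots> = cos (real i * pi / n - real j * pi / n) ^ k"
          using \<open>even k\<close> by (simp add: c_def left_diff_distrib diff_divide_distrib power_even_abs)
        finally show ?thesis .
      qed
      have "0 \<le> (\<Sum>i<n. \<Sum>j<n. v i * v j * c i j powr real k)"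
        unfolding ck by (rule cos_power_kernel_nonneg)
      moreover have "(\<Sum>i<n. \<Sum>j<n. v i * v j * c i j powr real k) - \<eta> * (\<Sum>i<n. \<bar>v i\<bar>)\<^sup>2 \<le>
          (\<Sum>i<n. \<Sum>j<n. v i * v j * c i j powr \<alpha>)"
        unfolding power2_eq_square sum_product
        unfolding sum_distrib_left sum_subtractf[symmetric]
      proof (intro sum_mono)
        fix i j assume "i \<in> {..<n}" "j \<in> {..<n}"
        then have "\<bar>v i * v j\<bar> * \<bar>c i j powr \<alpha> - c i j powr real k\<bar> \<le> \<bar>v i * v j\<bar> * \<eta>"
          using elim by (intro mult_left_mono) (auto intro: less_imp_le)
        then have "\<bar>v i * v j * (c i j powr \<alpha> - c i j powr real k)\<bar> \<le> \<eta> * (\<bar>v i\<bar> * \<bar>v j\<bar>)"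
          by (simp add: abs_mult mult_ac)
        then show "v i * v j * c i j powr real k - \<eta> * (\<bar>v i\<bar> * \<bar>v j\<bar>) \<le> v i * v j * c i j powr \<alpha>"
          by (simp add: right_diff_distrib abs_le_iff)
      qed
      moreover have "\<eta> * (\<Sum>i<n. \<bar>v i\<bar>)\<^sup>2 \<le> \<epsilon> * (\<Sum>i<n. (v i)\<^sup>2)"
        using mult_left_mono[OF sum_abs_square_le[of v n], of \<eta>] \<eta> \<open>0 < n\<close> by (simp add: \<eta>_def)
      moreover have "\<epsilon> * (\<Sum>i<n. (v i)\<^sup>2) \<le> ((1 + \<epsilon>) powr \<alpha> - 1) * (\<Sum>i<n. (v i)\<^sup>2)"
      proof (intro mult_right_mono sum_nonneg)
        have "(1 + \<epsilon>) powr 1 \<le> (1 + \<epsilon>) powr \<alpha>"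
          using elim \<open>0 < \<epsilon>\<close> by (intro powr_mono) auto
        then show "\<epsilon> \<le> (1 + \<epsilon>) powr \<alpha> - 1" using \<open>0 < \<epsilon>\<close> by simp
      qed auto
      ultimately show ?thesis
        unfolding cos_eps_form c_def by linarith
    qed
    then show ?case using elim \<open>0 < \<epsilon>\<close> by (subst mem_abs_psd_powers_iff) auto
  qed
qed

text \<open>
  The quadratic form is tested on the real and imaginary parts \<open>cos (2 m i \<pi> / n)\<close> and
  \<open>sin (2 m i \<pi> / n)\<close> of a Fourier mode. In the sum of the two values the products combine to
  \<open>cos (2 m (i - j) \<pi> / n)\<close>, and the squared norms add up to \<open>n\<close>.
\<close>

lemma cos_moment_bound_if_mem_abs_psd_powers:
  assumes "0 < n" "0 < p" "0 \<le> \<epsilon>"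
    and mem: "real p \<in> abs_psd_powers (cos_mat_eps n \<epsilon>)"
  shows "0 \<le> cos_moment n p (2 * int m) + ((1 + \<epsilon>) ^ p - 1)"
proof -
  define x where "x i = 2 * real m * (real i * pi / n)" for i
  define K where "K i j = \<bar>cos ((real i - real j) * pi / n)\<bar> ^ p" for i j
  have pw: "\<bar>y\<bar> powr real p = \<bar>y\<bar> ^ p" for y :: real
    using \<open>0 < p\<close> by (cases "y = 0") (auto simp: powr_realpow)
  have form: "0 \<le> (\<Sum>i<n. \<Sum>j<n. v i * v j * K i j) + ((1 + \<epsilon>) ^ p - 1) * (\<Sum>i<n. (v i)\<^sup>2)" for v
    using mem assms pw[of "1 + \<epsilon>"] mem_abs_psd_powers_iff[of \<epsilon> "real p" n]
    by (simp add: cos_eps_form pw K_def)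
  have "0 \<le> (\<Sum>i<n. \<Sum>j<n. cos (x i) * cos (x j) * K i j) +
      (\<Sum>i<n. \<Sum>j<n. sin (x i) * sin (x j) * K i j) +
      ((1 + \<epsilon>) ^ p - 1) * ((\<Sum>i<n. (cos (x i))\<^sup>2) + (\<Sum>i<n. (sin (x i))\<^sup>2))"
    using form[of "\<lambda>i. cos (x i)"] form[of "\<lambda>i. sin (x i)"] by (simp add: algebra_simps)
  also have "(\<Sum>i<n. (cos (x i))\<^sup>2) + (\<Sum>i<n. (sin (x i))\<^sup>2) = real n"
    by (simp add: sum.distrib[symmetric])
  also have "(\<Sum>i<n. \<Sum>j<n. cos (x i) * cos (x j) * K i j) +
      (\<Sum>i<n. \<Sum>j<n. sin (x i) * sin (x j) * K i j) =
      (\<Sum>i<n. \<Sum>j<n. K i j * cos (x i - x j))"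
    by (simp add: sum.distrib[symmetric] cos_diff algebra_simps)
  also have "\<dots> = real n * cos_moment n p (2 * int m)"
    using sum_abs_cos_pow_eq_cos_moment[OF \<open>0 < n\<close> \<open>0 < p\<close>, of m]
    by (simp add: K_def x_def left_diff_distrib right_diff_distrib diff_divide_distrib)
  finally have "0 \<le> real n * (cos_moment n p (2 * int m) + ((1 + \<epsilon>) ^ p - 1))"
    by (simp add: algebra_simps)
  then show ?thesis using \<open>0 < n\<close> by (simp add: zero_le_mult_iff)
qed

lemma eventually_not_mem_abs_psd_powers:
  assumes "odd p" "p + 3 \<le> n"
  shows "\<forall>\<^sub>F \<epsilon> in at_right 0. real p \<notin> abs_psd_powers (cos_mat_eps n \<epsilon>)"
proof -
  obtain m where m: "p + 3 = 2 * m" using \<open>odd p\<close> by (metis evenE odd_add odd_numeral)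
  then have q: "int p + 3 = 2 * int m" by linarith
  have neg: "cos_moment n p (2 * int m) < 0"
    using cos_moment_neg[OF assms] q by simp
  have "((\<lambda>\<epsilon>. cos_moment n p (2 * int m) + ((1 + \<epsilon>) ^ p - 1)) \<longlongrightarrow>
      cos_moment n p (2 * int m) + ((1 + 0) ^ p - 1)) (at_right (0::real))"
    by (intro tendsto_intros)
  then have "\<forall>\<^sub>F \<epsilon> in at_right 0. cos_moment n p (2 * int m) + ((1 + \<epsilon>) ^ p - 1) < 0"
    using neg by (intro order_tendstoD) auto
  moreover have "\<forall>\<^sub>F \<epsilon> in at_right 0. 0 < (\<epsilon>::real)"
    by (simp add: eventually_at_right_less)
  ultimately show ?thesis
  proof eventually_elim
    case (elim \<epsilon>)
    then show ?case
      using cos_moment_bound_if_mem_abs_psd_powers[of n p \<epsilon> m] assms odd_pos[OF \<open>odd p\<close>] by force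
  qed
qed

lemma finite_even_range: "finite (even_range n)"
  by (rule finite_subset[of _ "{..n}"]) (auto simp: even_range_def split: if_splits)

theorem theorem4:
  fixes n :: nat
  assumes "4 \<le> n"
  shows "\<exists>\<epsilon>\<^sub>0 > 0. \<forall>\<epsilon>. 0 < \<epsilon> \<and> \<epsilon> < \<epsilon>\<^sub>0 \<longrightarrow>
    (\<exists>\<delta> > 0. \<forall>k \<in> even_range n. {real k - \<delta> .. real k + \<delta>} \<subseteq> abs_psd_powers (cos_mat_eps n \<epsilon>)) \<and>
    (\<forall>k \<in> even_range n. real k - 1 \<notin> abs_psd_powers (cos_mat_eps n \<epsilon>))"
proof -
  let ?S = "\<lambda>\<epsilon>. abs_psd_powers (cos_mat_eps n \<epsilon>)"
  have "\<forall>\<^sub>F \<epsilon> in at_right 0. real k - 1 \<notin> ?S \<epsilon>" if "k \<in> even_range n" for k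
  proof -
    have "odd (k - 1)" "k - 1 + 3 \<le> n" and k: "real (k - 1) = real k - 1"
      using that \<open>4 \<le> n\<close> by (auto simp: even_range_def split: if_splits)
    then show ?thesis
      using eventually_not_mem_abs_psd_powers[of "k - 1" n] unfolding k by blast
  qed
  then have "\<forall>\<^sub>F \<epsilon> in at_right 0. \<forall>k \<in> even_range n. real k - 1 \<notin> ?S \<epsilon>"
    by (intro eventually_ball_finite finite_even_range ballI)
  then obtain \<epsilon>\<^sub>0 where \<epsilon>\<^sub>0: "0 < \<epsilon>\<^sub>0"
    "\<And>\<epsilon>. 0 < \<epsilon> \<Longrightarrow> \<epsilon> < \<epsilon>\<^sub>0 \<Longrightarrow> \<forall>k \<in> even_range n. real k - 1 \<notin> ?S \<epsilon>"
    unfolding eventually_at_right_field by blast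
  have "\<exists>\<delta> > 0. \<forall>k \<in> even_range n. {real k - \<delta> .. real k + \<delta>} \<subseteq> ?S \<epsilon>" if "0 < \<epsilon>" for \<epsilon>
  proof -
    have "\<exists>\<delta> > 0. {real k - \<delta> .. real k + \<delta>} \<subseteq> ?S \<epsilon>" if "k \<in> even_range n" for k
    proof -
      have "\<forall>\<^sub>F \<alpha> in nhds (real k). \<alpha> \<in> ?S \<epsilon>"
        using that \<open>0 < \<epsilon>\<close> \<open>4 \<le> n\<close>
        by (intro eventually_mem_abs_psd_powers) (auto simp: even_range_def)
      then obtain d where "0 < d" "\<And>\<alpha>. dist \<alpha> (real k) < d \<Longrightarrow> \<alpha> \<in> ?S \<epsilon>"
        unfolding eventually_nhds_metric by blast
      then show ?thesis
        by (intro exI[of _ "d / 2"]) (auto simp: dist_real_def abs_if)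
    qed
    then obtain D where D: "\<And>k. k \<in> even_range n \<Longrightarrow> 0 < D k \<and> {real k - D k .. real k + D k} \<subseteq> ?S \<epsilon>"
      by metis
    define \<delta> where "\<delta> = Min (insert 1 (D ` even_range n))"
    have le: "\<delta> \<le> D k" if "k \<in> even_range n" for k
      unfolding \<delta>_def using that finite_even_range by (intro Min_le) auto
    have "0 < \<delta>"
      unfolding \<delta>_def using D finite_even_range by (subst Min_gr_iff) auto
    moreover have "{real k - \<delta> .. real k + \<delta>} \<subseteq> ?S \<epsilon>" if "k \<in> even_range n" for k
    proof -
      have "{real k - \<delta> .. real k + \<delta>} \<subseteq> {real k - D k .. real k + D k}"
        using le[OF that] by auto
      with D[OF that] show ?thesis by blast
    qed
    ultimately show ?thesis by blast
  qed
  with \<epsilon>\<^sub>0 show ?thesis by blast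
qed

end
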